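(* Let $n$ be a positive integer and $\alpha$ a real number with $n+\alpha>0$ and $n+2\alpha>0$. Let $x_1<x_2<\cdots$ be the consecutive zeros of the ultraspherical polynomial $P_n^{(\alpha,\alpha)}$ in $(-1,1)$, let $\Delta x_k=x_{k+1}-x_k$, and put $$F(t)=\frac{-(\alpha+n)(\alpha+n+1)t^2+(1+n+n^2+\alpha+2\alpha n)}{(t^2-1)^2}.$$ Suppose $|\alpha|>1$ and $(n+\alpha)(n+\alpha+1)>2(\alpha^2-1)$, and let $$T_2=\sqrt{\frac{(n+\alpha)(n+\alpha+1)-2(\alpha^2-1)}{(n+\alpha)(n+\alpha+1)}},\qquad T_1=-T_2.$$ Then the zeros of $P_n^{(\alpha,\alpha)}$ are concave on $(-1,T_1)$ and on $(0,T_2)$, and convex on $(T_1,0)$ and on $(T_2,1)$. Also, for all pairs of consecutive zeros $x_k,x_{k+1}$ in $(-1,1)$, $$\Delta x_k>\frac{\pi}{\sqrt{F(T_2)}};$$ moreover, if $(x_k,x_{k+1})\subset(T_1,T_2)$, then $$\Delta x_k<\frac{\pi}{\sqrt{F(0)}},$$ and if $(x_k,x_{k+1})\subset(0,T_2)$, then $$\frac{\pi}{\sqrt{F(x_{k+1})}}<\Delta x_k<\frac{\pi}{\sqrt{F(x_k)}}.$$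
   Context: $P_n^{(\alpha,\alpha)}$ is the Jacobi polynomial with equal parameters (ultraspherical polynomial), defined for all real $\alpha$ by $$P_n^{(\alpha,\alpha)}(t)=\sum_{s=0}^{n}\binom{n+\alpha}{n-s}\binom{n+\alpha}{s}\left(\frac{t-1}{2}\right)^{s}\left(\frac{t+1}{2}\right)^{n-s};$$ it satisfies $(1-t^2)x''-(2\alpha+2)t\,x'+n(n+2\alpha+1)x=0$. Convexity convention: the zeros of a function on an interval $(a,b)$, listed in increasing order (only those lying in $(a,b)$), are called convex on $(a,b)$ if $x_{k+2}-x_{k+1}>x_{k+1}-x_k$ for every three consecutive zeros $x_k<x_{k+1}<x_{k+2}$ in $(a,b)$, and concave on $(a,b)$ if $x_{k+2}-x_{k+1}<x_{k+1}-x_k$ for every three consecutive zeros in $(a,b)$. *)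

theory Defs
  imports Complex_Main
begin

text \<open>The polynomial \<open>P\<^sub>n\<close> with equal Jacobi parameters \<open>(\<alpha>, \<alpha>)\<close>, as a function on the reals.\<close>

definition ultraspherical :: "nat \<Rightarrow> real \<Rightarrow> real \<Rightarrow> real" where
  "ultraspherical n \<alpha> t =
     (\<Sum>s=0..n. ((real n + \<alpha>) gchoose (n - s)) * ((real n + \<alpha>) gchoose s)
                * ((t - 1) / 2) ^ s * ((t + 1) / 2) ^ (n - s))"

definition zeros_in :: "(real \<Rightarrow> real) \<Rightarrow> real \<Rightarrow> real \<Rightarrow> real set" where
  "zeros_in f a b = {t \<in> {a<..<b}. f t = 0}"

text \<open>\<open>consecutive_zeros f a b x y\<close> says that \<open>x\<close> and \<open>y\<close> are neighbours, in this order, in the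
  increasing enumeration of the zeros of \<open>f\<close> in the open interval \<open>(a, b)\<close>, that is,
  \<open>x = x\<^sub>k\<close> and \<open>y = x\<^sub>k\<^sub>+\<^sub>1\<close> for some \<open>k\<close>.\<close>

definition consecutive_zeros ::
    "(real \<Rightarrow> real) \<Rightarrow> real \<Rightarrow> real \<Rightarrow> real \<Rightarrow> real \<Rightarrow> bool" where
  "consecutive_zeros f a b x y \<longleftrightarrow>
     x \<in> zeros_in f a b \<and> y \<in> zeros_in f a b \<and> x < y \<and> zeros_in f a b \<inter> {x<..<y} = {}"

definition zeros_convex_on :: "(real \<Rightarrow> real) \<Rightarrow> real \<Rightarrow> real \<Rightarrow> bool" where
  "zeros_convex_on f a b \<longleftrightarrow>
     (\<forall>x y z. consecutive_zeros f a b x y \<and> consecutive_zeros f a b y z \<longrightarrow> z - y > y - x)"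

definition zeros_concave_on :: "(real \<Rightarrow> real) \<Rightarrow> real \<Rightarrow> real \<Rightarrow> bool" where
  "zeros_concave_on f a b \<longleftrightarrow>
     (\<forall>x y z. consecutive_zeros f a b x y \<and> consecutive_zeros f a b y z \<longrightarrow> z - y < y - x)"

end

theory Submission
  imports Defs
begin

text \<open>
  Multiplying \<open>P = ultraspherical n \<alpha>\<close> by the positive weight
  \<open>(1 - t\<^sup>2) powr ((\<alpha> + 1) / 2)\<close> keeps its zeros in \<open>(-1, 1)\<close> and removes the first-order
  term of its differential equation: the product \<open>u\<close> satisfies \<open>u'' = - F u\<close>
  (\<open>ultraspherical_normal_form\<close>, based on \<open>ultraspherical_ode\<close>). So the zeros are those of an
  oscillator whose frequency \<open>sqrt F\<close> varies with position, and by Sturm's comparison theorem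
  they lie closer together where \<open>F\<close> is larger.

  The comparison is needed between gaps that start at different points. \<open>sturm_gap\<close> says: if,
  measured from the left ends of two gaps, the coefficient over the second one is at least that
  over the first, and equal to it at only finitely many places, then the second gap is shorter.
  Comparing two neighbouring gaps of \<open>u\<close> yields concavity where \<open>F\<close> increases and convexity
  where it decreases; comparing a gap of \<open>u\<close> with the gap \<open>\<pi> / sqrt K\<close> of
  \<open>sin (sqrt K * t)\<close> yields the explicit bounds on its length.

  What remains is calculus. Write \<open>A = (n + \<alpha>) (n + \<alpha> + 1)\<close>, \<open>B = \<alpha>\<^sup>2 - 1\<close> and
  \<open>w = 1 / (1 - t\<^sup>2)\<close>. Then \<open>F = A w - B w\<^sup>2\<close> is a concave parabola in \<open>w\<close>, with vertex at
  \<open>w = A / (2 B)\<close>, which is the value of \<open>w\<close> at \<open>\<plusminus> T2\<close>. Since \<open>w\<close> increases with \<open>\<bar>t\<bar>\<close>,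
  \<open>F\<close> increases with \<open>\<bar>t\<bar>\<close> up to \<open>T2\<close> and decreases beyond it (\<open>coefficient_monotone\<close>).
\<close>

section \<open>The ultraspherical differential equation\<close>

text \<open>
  With \<open>c s\<close> the \<open>s\<close>-th coefficient of the polynomial, this reads
  \<open>c (s + 1) (s + 1) (s + 1 + \<alpha>) = c s (n - s) (n - s + \<alpha>)\<close>. One absorption identity raises the
  lower index of one binomial coefficient and a second one lowers that of the other. It is the
  recurrence that makes the series solve the differential equation.
\<close>

lemma ultraspherical_coeff_rec:
  fixes \<alpha> :: real
  assumes "s < n"
  shows "((real n + \<alpha>) gchoose (n - Suc s)) * ((real n + \<alpha>) gchoose Suc s)
           * (real (Suc s) * (real (Suc s) + \<alpha>))
       = ((real n + \<alpha>) gchoose (n - s)) * ((real n + \<alpha>) gchoose s)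
           * (real (n - s) * (real (n - s) + \<alpha>))"
proof -
  let ?N = "real n + \<alpha>"
  define m where "m = n - Suc s"
  have m: "n - s = Suc m" "n - Suc s = m" "real m = real n - real s - 1"
    using assms by (auto simp: m_def of_nat_diff)
  have 1: "real (Suc s) * (?N gchoose Suc s) = (?N - real s) * (?N gchoose s)"
    using gbinomial_mult_1[of ?N s] by (simp add: algebra_simps)
  have 2: "real (Suc m) * (?N gchoose Suc m) = (?N - real m) * (?N gchoose m)"
    using gbinomial_mult_1[of ?N m] by (simp add: algebra_simps)
  have "(?N gchoose m) * (?N gchoose Suc s) * (real (Suc s) * (real (Suc s) + \<alpha>))
      = (?N - real m) * (?N gchoose m) * (real (Suc s) * (?N gchoose Suc s))"
    using m(3) by simp
  also have "\<dots> = real (Suc m) * (?N gchoose Suc m) * ((?N - real s) * (?N gchoose s))"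
    by (simp only: 1 2)
  also have "\<dots> = (?N gchoose Suc m) * (?N gchoose s) * (real (Suc m) * (real (Suc m) + \<alpha>))"
    using m(3) by simp
  finally show ?thesis by (simp only: m)
qed

text \<open>
  The basis in which the polynomial is given; \<open>power_prod1\<close> and \<open>power_prod2\<close> are its first two
  derivatives. An exponent truncated at \<open>0 - 1 = 0\<close> always comes with a factor \<open>0\<close>.
\<close>

definition power_prod :: "nat \<Rightarrow> nat \<Rightarrow> real \<Rightarrow> real" where
  "power_prod i j t = ((t - 1) / 2) ^ i * ((t + 1) / 2) ^ j"

definition power_prod1 :: "nat \<Rightarrow> nat \<Rightarrow> real \<Rightarrow> real" where
  "power_prod1 i j t = (real i * power_prod (i - 1) j t + real j * power_prod i (j - 1) t) / 2"

definition power_prod2 :: "nat \<Rightarrow> nat \<Rightarrow> real \<Rightarrow> real" where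
  "power_prod2 i j t = (real i * power_prod1 (i - 1) j t + real j * power_prod1 i (j - 1) t) / 2"

lemma power_prod_DERIV:
  "(power_prod i j has_real_derivative power_prod1 i j t) (at t)"
proof -
  have "((\<lambda>t. ((t - 1) / 2) ^ i) has_real_derivative real i * ((t - 1) / 2) ^ (i - 1) * (1 / 2)) (at t)"
       "((\<lambda>t. ((t + 1) / 2) ^ j) has_real_derivative real j * ((t + 1) / 2) ^ (j - 1) * (1 / 2)) (at t)"
    by (rule derivative_eq_intros refl | simp)+
  from DERIV_mult[OF this] show ?thesis
    unfolding power_prod_def[abs_def] power_prod1_def power_prod_def
    by (rule DERIV_cong) (simp only: add_divide_distrib mult.assoc mult.commute mult.left_commute
        times_divide_eq_right mult_1_right mult_1_left add.commute)
qed

lemma power_prod1_DERIV: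
  "(power_prod1 i j has_real_derivative power_prod2 i j t) (at t)"
  unfolding power_prod1_def[abs_def] power_prod2_def
  by (auto intro!: derivative_eq_intros power_prod_DERIV simp: power_prod1_def field_simps)

text \<open>
  With \<open>p = (t - 1) / 2\<close> and \<open>q = (t + 1) / 2\<close> one has \<open>t = p + q\<close> and \<open>1 - t\<^sup>2 = - 4 p q\<close>, so
  the differential operator maps \<open>p\<^sup>i q\<^sup>j\<close> to a combination of that monomial and its two neighbours
  of the same total degree. Only neighbouring coefficients interact, so a two-term recurrence
  suffices.
\<close>

lemma power_prod_operator:
  fixes \<alpha> :: real
  shows "(1 - t\<^sup>2) * power_prod2 i j t - (2 * \<alpha> + 2) * t * power_prod1 i j t
           + real (i + j) * (real (i + j) + 2 * \<alpha> + 1) * power_prod i j t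
       = (real i * (real i + \<alpha>) + real j * (real j + \<alpha>)) * power_prod i j t
           - real i * (real i + \<alpha>) * power_prod (i - 1) (j + 1) t
           - real j * (real j + \<alpha>) * power_prod (i + 1) (j - 1) t"
proof -
  define p q where "p = (t - 1) / 2" and "q = (t + 1) / 2"
  have t: "t = p + q" "1 - t\<^sup>2 = - 4 * p * q"
    by (simp_all add: p_def q_def field_simps power2_eq_square)
  \<comment> \<open>Multiplying by \<open>x\<close> undoes the drop in the exponent, even where the subtraction is truncated.\<close>
  have drop: "real k * x ^ (k - 1) * x = real k * x ^ k"
       "real k * real (k - 1) * x ^ (k - 1 - 1) * x = (real k - 1) * (real k * x ^ (k - 1))" for k and x :: real
    by (cases k; simp)(cases k; cases "k - 1"; simp)
  define a a2 b b2 where "a = real i * p ^ (i - 1)" and "a2 = real i * real (i - 1) * p ^ (i - 1 - 1)"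
    and "b = real j * q ^ (j - 1)" and "b2 = real j * real (j - 1) * q ^ (j - 1 - 1)"
  have r: "a * p = real i * p ^ i" "a2 * p = (real i - 1) * a"
          "b * q = real j * q ^ j" "b2 * q = (real j - 1) * b"
    unfolding a_def a2_def b_def b2_def using drop by blast+
  have pp: "power_prod k l t = p ^ k * q ^ l" for k l
    by (simp only: power_prod_def p_def q_def)
  have P1: "power_prod1 i j t = (a * q ^ j + b * p ^ i) / 2"
    by (simp add: power_prod1_def pp a_def b_def)
  have P2: "power_prod2 i j t = (a2 * q ^ j + 2 * a * b + b2 * p ^ i) / 4"
    by (simp add: power_prod2_def power_prod1_def pp a_def b_def a2_def b2_def field_simps)
  have P0: "power_prod i j t = p ^ i * q ^ j"
    "real i * power_prod (i - 1) (j + 1) t = a * q ^ j * q"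
    "real j * power_prod (i + 1) (j - 1) t = b * p ^ i * p"
    by (simp_all add: pp a_def b_def)
  have "(1 - t\<^sup>2) * power_prod2 i j t - (2 * \<alpha> + 2) * t * power_prod1 i j t
      = - ((a2 * p) * q * q ^ j + 2 * (a * p) * (b * q) + (b2 * q) * p * p ^ i)
        - (\<alpha> + 1) * ((a * p) * q ^ j + q * a * q ^ j + (b * q) * p ^ i + p * b * p ^ i)"
    unfolding P1 P2 t(2) by (simp add: t(1) field_simps)
  also have "\<dots> = - (real i + \<alpha>) * (a * q ^ j * q) - (real j + \<alpha>) * (b * p ^ i * p)
      - (2 * real i * real j + (\<alpha> + 1) * (real i + real j)) * (p ^ i * q ^ j)"
    unfolding r by (simp add: algebra_simps)
  finally have "(1 - t\<^sup>2) * power_prod2 i j t - (2 * \<alpha> + 2) * t * power_prod1 i j t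
     = - (real i + \<alpha>) * (real i * power_prod (i - 1) (j + 1) t)
       - (real j + \<alpha>) * (real j * power_prod (i + 1) (j - 1) t)
       - (2 * real i * real j + (\<alpha> + 1) * (real i + real j)) * power_prod i j t"
    by (simp only: P0)
  then show ?thesis by (simp add: algebra_simps)
qed

text \<open>
  Applied to the sum, the operator of \<open>power_prod_operator\<close> sends to the monomial of index \<open>s\<close> the
  weights \<open>d s + e s\<close> from the term \<open>s\<close> itself, \<open>- d (s + 1)\<close> from above and \<open>- e (s - 1)\<close> from
  below. These cancel because \<open>d (s + 1) = e s\<close>, and the ends match because \<open>d 0 = e n = 0\<close>.
\<close>

lemma ultraspherical_ode:
  obtains P' P'' where
    "\<And>t. (ultraspherical n \<alpha> has_real_derivative P' t) (at t)"
    "\<And>t. (P' has_real_derivative P'' t) (at t)"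
    "\<And>t. (1 - t\<^sup>2) * P'' t - (2 * \<alpha> + 2) * t * P' t
            + real n * (real n + 2 * \<alpha> + 1) * ultraspherical n \<alpha> t = 0"
proof
  define c where "c s = ((real n + \<alpha>) gchoose (n - s)) * ((real n + \<alpha>) gchoose s)" for s
  define d where "d s = c s * (real s * (real s + \<alpha>))" for s
  define e where "e s = c s * (real (n - s) * (real (n - s) + \<alpha>))" for s
  let ?P' = "\<lambda>t. \<Sum>s=0..n. c s * power_prod1 s (n - s) t"
  let ?P'' = "\<lambda>t. \<Sum>s=0..n. c s * power_prod2 s (n - s) t"
  have P: "ultraspherical n \<alpha> = (\<lambda>t. \<Sum>s=0..n. c s * power_prod s (n - s) t)"
    by (simp add: ultraspherical_def c_def power_prod_def mult.assoc fun_eq_iff)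
  show "(ultraspherical n \<alpha> has_real_derivative ?P' t) (at t)" for t
    unfolding P by (auto intro!: derivative_eq_intros power_prod_DERIV simp: mult.commute)
  show "(?P' has_real_derivative ?P'' t) (at t)" for t
    by (auto intro!: derivative_eq_intros power_prod1_DERIV simp: mult.commute)
  have de: "d (Suc s) = e s" if "s < n" for s
    unfolding d_def e_def c_def by (rule ultraspherical_coeff_rec[OF that])
  have ends: "d 0 = 0" "e n = 0" by (simp_all add: d_def e_def)
  show "(1 - t\<^sup>2) * ?P'' t - (2 * \<alpha> + 2) * t * ?P' t
          + real n * (real n + 2 * \<alpha> + 1) * ultraspherical n \<alpha> t = 0" for t
  proof -
    have summand: "c s * ((1 - t\<^sup>2) * power_prod2 s (n - s) t - (2 * \<alpha> + 2) * t * power_prod1 s (n - s) t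
             + real n * (real n + 2 * \<alpha> + 1) * power_prod s (n - s) t)
          = (d s + e s) * power_prod s (n - s) t
            - d s * power_prod (s - 1) (n - s + 1) t - e s * power_prod (s + 1) (n - s - 1) t"
      if "s \<le> n" for s
    proof -
      have "s + (n - s) = n" using that by simp
      from power_prod_operator[of t s "n - s" \<alpha>, unfolded this] show ?thesis
        by (simp only: d_def e_def) (simp add: algebra_simps)
    qed
    have up: "(\<Sum>s=0..n. d s * power_prod (s - 1) (n - s + 1) t) = (\<Sum>s=0..n. e s * power_prod s (n - s) t)"
    proof (cases n)
      case (Suc m)
      have "(\<Sum>s=0..n. d s * power_prod (s - 1) (n - s + 1) t)
          = (\<Sum>s=0..m. d (Suc s) * power_prod s (n - Suc s + 1) t)"
        unfolding Suc by (subst sum.atLeast0_atMost_Suc_shift) (simp add: ends)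
      also have "\<dots> = (\<Sum>s=0..m. e s * power_prod s (n - s) t)"
        by (rule sum.cong) (auto simp: Suc de Suc_diff_le)
      also have "\<dots> = (\<Sum>s=0..n. e s * power_prod s (n - s) t)"
        using ends by (simp add: Suc)
      finally show ?thesis .
    qed (simp add: d_def e_def)
    have down: "(\<Sum>s=0..n. e s * power_prod (s + 1) (n - s - 1) t) = (\<Sum>s=0..n. d s * power_prod s (n - s) t)"
    proof (cases n)
      case (Suc m)
      have "(\<Sum>s=0..n. d s * power_prod s (n - s) t)
          = (\<Sum>s=0..m. d (Suc s) * power_prod (Suc s) (n - Suc s) t)"
        unfolding Suc by (subst sum.atLeast0_atMost_Suc_shift) (simp add: ends)
      also have "\<dots> = (\<Sum>s=0..m. e s * power_prod (s + 1) (n - s - 1) t)"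
        by (rule sum.cong) (auto simp: Suc de)
      also have "\<dots> = (\<Sum>s=0..n. e s * power_prod (s + 1) (n - s - 1) t)"
        using ends by (simp add: Suc)
      finally show ?thesis by simp
    qed (simp add: d_def e_def)
    have "(1 - t\<^sup>2) * ?P'' t - (2 * \<alpha> + 2) * t * ?P' t
          + real n * (real n + 2 * \<alpha> + 1) * ultraspherical n \<alpha> t
        = (\<Sum>s=0..n. c s * ((1 - t\<^sup>2) * power_prod2 s (n - s) t
             - (2 * \<alpha> + 2) * t * power_prod1 s (n - s) t
             + real n * (real n + 2 * \<alpha> + 1) * power_prod s (n - s) t))"
      unfolding P
      by (simp add: sum_distrib_left sum.distrib sum_subtractf algebra_simps)
    also have "\<dots> = (\<Sum>s=0..n. (d s + e s) * power_prod s (n - s) t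
            - d s * power_prod (s - 1) (n - s + 1) t - e s * power_prod (s + 1) (n - s - 1) t)"
      by (rule sum.cong) (simp_all only: summand atLeastAtMost_iff)
    also have "\<dots> = 0"
      by (simp only: sum_subtractf distrib_right sum.distrib up down)
    finally show ?thesis .
  qed
qed

section \<open>Liouville normal form\<close>

text \<open>
  A factor \<open>g\<close> removes the first-order term when \<open>g' / g = - (\<alpha> + 1) t / (1 - t\<^sup>2)\<close>, half the
  coefficient of \<open>P'\<close> in the normalised equation; this forces
  \<open>g = (1 - t\<^sup>2) powr ((\<alpha> + 1) / 2)\<close>. The factor does not vanish on \<open>(-1, 1)\<close>, so it leaves
  the zeros there unchanged.
\<close>

lemma ultraspherical_normal_form:
  fixes n :: nat and \<alpha> :: real
  defines "A \<equiv> (real n + \<alpha>) * (real n + \<alpha> + 1)"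
  obtains u u' where
    "\<And>t. \<bar>t\<bar> < 1 \<Longrightarrow> (u has_real_derivative u' t) (at t)"
    "\<And>t. \<bar>t\<bar> < 1 \<Longrightarrow>
       (u' has_real_derivative - (A / (1 - t\<^sup>2) - (\<alpha>\<^sup>2 - 1) / (1 - t\<^sup>2)\<^sup>2) * u t) (at t)"
    "\<And>t. \<bar>t\<bar> < 1 \<Longrightarrow> u t = 0 \<longleftrightarrow> ultraspherical n \<alpha> t = 0"
proof -
  obtain P' P'' where P': "\<And>t. (ultraspherical n \<alpha> has_real_derivative P' t) (at t)"
    and P'': "\<And>t. (P' has_real_derivative P'' t) (at t)"
    and ode: "\<And>t. (1 - t\<^sup>2) * P'' t - (2 * \<alpha> + 2) * t * P' t
            + real n * (real n + 2 * \<alpha> + 1) * ultraspherical n \<alpha> t = 0"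
    using ultraspherical_ode by metis
  define P where "P = ultraspherical n \<alpha>"
  define g where "g t = (1 - t\<^sup>2) powr ((\<alpha> + 1) / 2)" for t :: real
  have g_nz: "g t \<noteq> 0" and m: "1 - t\<^sup>2 > 0" if "\<bar>t\<bar> < 1" for t
    using that abs_square_less_1[of t] by (auto simp: g_def)
  have g': "(g has_real_derivative - ((\<alpha> + 1) * t / (1 - t\<^sup>2)) * g t) (at t)" if "\<bar>t\<bar> < 1" for t
  proof -
    have "((\<lambda>t. 1 - t\<^sup>2) has_real_derivative - 2 * t) (at t)"
      by (auto intro!: derivative_eq_intros)
    from DERIV_fun_powr[OF this m[OF that], of "(\<alpha> + 1) / 2"] show ?thesis
      unfolding g_def[abs_def]
      by (rule DERIV_cong) (use m[OF that] in \<open>simp only: powr_diff of_nat_1 powr_one; simp add: divide_simps; simp add: algebra_simps\<close>)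
  qed
  define u where "u t = g t * P t" for t
  define u' where "u' t = g t * (P' t - (\<alpha> + 1) * t / (1 - t\<^sup>2) * P t)" for t
  show thesis
  proof
    fix t :: real assume t: "\<bar>t\<bar> < 1"
    show "(u has_real_derivative u' t) (at t)"
      unfolding u_def u'_def P_def
      by (rule derivative_eq_intros g'[OF t] P')+ (simp add: algebra_simps)
    define k where "k = 1 - t\<^sup>2"
    have k: "k > 0" "t\<^sup>2 = 1 - k" using m[OF t] by (auto simp: k_def)
    have ode': "P'' t = (2 * (\<alpha> + 1) * t * P' t - real n * (real n + 2 * \<alpha> + 1) * P t) / k"
      using ode[of t] k(1) by (simp add: P_def k_def[symmetric] field_simps)
    have D: "((\<lambda>t. (\<alpha> + 1) * t / (1 - t\<^sup>2)) has_real_derivative (\<alpha> + 1) * (2 / k\<^sup>2 - 1 / k)) (at t)"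
    proof -
      have "((\<lambda>t. (\<alpha> + 1) * t) has_real_derivative \<alpha> + 1) (at t)"
        "((\<lambda>t. 1 - t\<^sup>2) has_real_derivative - (2 * t)) (at t)"
        by (auto intro!: derivative_eq_intros)
      from DERIV_divide[OF this] m[OF t]
      have "((\<lambda>t. (\<alpha> + 1) * t / (1 - t\<^sup>2)) has_real_derivative
          ((\<alpha> + 1) * k + 2 * (\<alpha> + 1) * t\<^sup>2) / k\<^sup>2) (at t)"
        by (simp add: k_def power2_eq_square algebra_simps)
      then show ?thesis
        by (rule DERIV_cong) (subst k(2), use k(1) in \<open>simp add: field_simps power2_eq_square\<close>)
    qed
    have "(u' has_real_derivative
        - ((\<alpha> + 1) * t / k) * g t * (P' t - (\<alpha> + 1) * t / k * P t)
        + g t * (P'' t - ((\<alpha> + 1) * (2 / k\<^sup>2 - 1 / k) * P t + (\<alpha> + 1) * t / k * P' t))) (at t)"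
      unfolding u'_def P_def k_def
      by (rule derivative_eq_intros g'[OF t] P' P'' D[unfolded k_def] refl)+ (simp add: algebra_simps)
    also have "- ((\<alpha> + 1) * t / k) * g t * (P' t - (\<alpha> + 1) * t / k * P t)
        + g t * (P'' t - ((\<alpha> + 1) * (2 / k\<^sup>2 - 1 / k) * P t + (\<alpha> + 1) * t / k * P' t))
      = g t * (P'' t - 2 * (\<alpha> + 1) * t * P' t / k
          + ((\<alpha> + 1)\<^sup>2 * t\<^sup>2 / k\<^sup>2 - (\<alpha> + 1) * (2 / k\<^sup>2 - 1 / k)) * P t)"
      using k(1) by (simp add: field_simps power2_eq_square)
    also have "\<dots> = g t * P t * (- real n * (real n + 2 * \<alpha> + 1) / k
          + ((\<alpha> + 1)\<^sup>2 * (1 - k) / k\<^sup>2 - (\<alpha> + 1) * (2 / k\<^sup>2 - 1 / k)))"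
      unfolding ode' k(2) using k(1) by (simp add: field_simps)
    also have "\<dots> = - (A / k - (\<alpha>\<^sup>2 - 1) / k\<^sup>2) * u t"
      using k(1) by (simp add: u_def A_def field_simps power2_eq_square)
    finally show "(u' has_real_derivative - (A / (1 - t\<^sup>2) - (\<alpha>\<^sup>2 - 1) / (1 - t\<^sup>2)\<^sup>2) * u t) (at t)"
      unfolding k_def .
    show "u t = 0 \<longleftrightarrow> ultraspherical n \<alpha> t = 0"
      using g_nz[OF t] by (simp add: u_def P_def)
  qed
qed

section \<open>Sturm comparison of gaps\<close>

definition sturm_solution ::
    "(real \<Rightarrow> real) \<Rightarrow> real set \<Rightarrow> (real \<Rightarrow> real) \<Rightarrow> (real \<Rightarrow> real) \<Rightarrow> bool" where
  "sturm_solution p S u u' \<longleftrightarrow>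
     (\<forall>t\<in>S. (u has_real_derivative u' t) (at t) \<and> (u' has_real_derivative - p t * u t) (at t))"

lemma sturm_solution_subset:
  "sturm_solution p S u u' \<Longrightarrow> R \<subseteq> S \<Longrightarrow> sturm_solution p R u u'"
  by (auto simp: sturm_solution_def)

lemma sturm_solution_cmult:
  assumes "sturm_solution p S u u'"
  shows "sturm_solution p S (\<lambda>t. k * u t) (\<lambda>t. k * u' t)"
  using assms unfolding sturm_solution_def
  by (auto intro!: derivative_eq_intros)

lemma sturm_solution_shift:
  assumes "sturm_solution p {a + h..b + h} u u'"
  shows "sturm_solution (\<lambda>t. p (t + h)) {a..b} (\<lambda>t. u (t + h)) (\<lambda>t. u' (t + h))"
  unfolding sturm_solution_def
proof (intro ballI conjI)
  fix t assume "t \<in> {a..b}"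
  with assms have "(u has_real_derivative u' (t + h)) (at (t + h))"
    "(u' has_real_derivative - p (t + h) * u (t + h)) (at (t + h))"
    by (auto simp: sturm_solution_def)
  then show "((\<lambda>t. u (t + h)) has_real_derivative u' (t + h)) (at t)"
    "((\<lambda>t. u' (t + h)) has_real_derivative - p (t + h) * u (t + h)) (at t)"
    by (simp_all only: DERIV_shift)
qed

lemma sturm_solution_continuous_on:
  "sturm_solution p S u u' \<Longrightarrow> continuous_on S u"
  by (meson sturm_solution_def DERIV_isCont continuous_at_imp_continuous_on)

lemma sturm_solution_sin:
  assumes "K > 0"
  shows "sturm_solution (\<lambda>_. K) S (\<lambda>t. sin (sqrt K * t)) (\<lambda>t. sqrt K * cos (sqrt K * t))"
  using assms unfolding sturm_solution_def
  by (auto intro!: derivative_eq_intros)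

text \<open>The factor \<open>k\<close> is the sign of \<open>f\<close>, so that solutions can be rescaled to be positive.\<close>

lemma constant_sign:
  fixes f :: "real \<Rightarrow> real"
  assumes "continuous_on {a<..<b} f" and "\<And>t. a < t \<Longrightarrow> t < b \<Longrightarrow> f t \<noteq> 0"
  obtains k :: real where "\<And>t. a < t \<Longrightarrow> t < b \<Longrightarrow> k * f t > 0"
proof -
  have "connected (f ` {a<..<b})"
    using assms(1) by (rule connected_continuous_image) simp
  then have iv: "0 \<in> f ` {a<..<b}" if "x \<in> {a<..<b}" "y \<in> {a<..<b}" "f x \<le> 0" "0 \<le> f y" for x y
    using that by (meson connectedD_interval imageI)
  have "(\<forall>t\<in>{a<..<b}. f t > 0) \<or> (\<forall>t\<in>{a<..<b}. f t < 0)"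
    using iv assms(2) by (force simp: not_less)
  then show thesis
    using that[of 1] that[of "-1"] by force
qed

text \<open>
  The Wronskian \<open>W = u' v - u v'\<close> has derivative \<open>(q - p) u v \<ge> 0\<close>. At the ends
  \<open>W = u' v\<close>, and \<open>u' a \<ge> 0 \<ge> u' b\<close> because \<open>u\<close> is positive in between; hence
  \<open>W b \<le> 0 \<le> W a\<close>. A nondecreasing function with these end values is constant, so its derivative
  vanishes. Concluding equality of the coefficients, instead of assuming strictness somewhere and
  deriving a contradiction, leaves room for coefficients that touch at isolated points, as \<open>F\<close>
  and its extreme values do.
\<close>

lemma sturm_separation:
  assumes "a < b"
    and u: "sturm_solution p {a..b} u u'" and v: "sturm_solution q {a..b} v v'"
    and u0: "u a = 0" "u b = 0"
    and upos: "\<And>t. a < t \<Longrightarrow> t < b \<Longrightarrow> u t > 0"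
    and vpos: "\<And>t. a < t \<Longrightarrow> t < b \<Longrightarrow> v t > 0"
    and le: "\<And>t. a < t \<Longrightarrow> t < b \<Longrightarrow> p t \<le> q t"
    and s: "a < s" "s < b"
  shows "p s = q s"
proof -
  have du: "(u has_real_derivative u' t) (at t)" "(u' has_real_derivative - p t * u t) (at t)"
    and dv: "(v has_real_derivative v' t) (at t)" "(v' has_real_derivative - q t * v t) (at t)"
    if "a \<le> t" "t \<le> b" for t
    using u v that by (auto simp: sturm_solution_def)
  \<comment> \<open>A negative slope at \<open>a\<close> would make \<open>u\<close> negative just to the right of \<open>a\<close>; likewise at \<open>b\<close>.\<close>
  have "u' a \<ge> 0"
  proof (rule ccontr)
    assume "\<not> u' a \<ge> 0"
    then obtain e where e: "e > 0" "\<And>h. 0 < h \<Longrightarrow> h < e \<Longrightarrow> u (a + h) < u a"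
      using DERIV_neg_dec_right[OF du(1)[of a]] \<open>a < b\<close> by auto
    define h where "h = min e (b - a) / 2"
    have "0 < h" "h < e" "a + h < b" using e(1) \<open>a < b\<close> by (auto simp: h_def min_def field_simps)
    then show False using e(2)[of h] upos[of "a + h"] u0 by simp
  qed
  have "u' b \<le> 0"
  proof (rule ccontr)
    assume "\<not> u' b \<le> 0"
    then obtain e where e: "e > 0" "\<And>h. 0 < h \<Longrightarrow> h < e \<Longrightarrow> u (b - h) < u b"
      using DERIV_pos_inc_left[OF du(1)[of b]] \<open>a < b\<close> by auto
    define h where "h = min e (b - a) / 2"
    have "0 < h" "h < e" "a < b - h" using e(1) \<open>a < b\<close> by (auto simp: h_def min_def field_simps)
    then show False using e(2)[of h] upos[of "b - h"] u0 by simp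
  qed
  have "v a \<ge> 0"
  proof (rule tendsto_lowerbound)
    show "(v \<longlongrightarrow> v a) (at_right a)"
      using DERIV_isCont[OF dv(1)[of a]] \<open>a < b\<close>
      by (simp add: isCont_def filterlim_at_split)
    show "\<forall>\<^sub>F t in at_right a. 0 \<le> v t"
      using \<open>a < b\<close> vpos by (auto simp: eventually_at_right intro!: exI[of _ b] less_imp_le)
  qed simp
  have "v b \<ge> 0"
  proof (rule tendsto_lowerbound)
    show "(v \<longlongrightarrow> v b) (at_left b)"
      using DERIV_isCont[OF dv(1)[of b]] \<open>a < b\<close>
      by (simp add: isCont_def filterlim_at_split)
    show "\<forall>\<^sub>F t in at_left b. 0 \<le> v t"
      using \<open>a < b\<close> vpos by (auto simp: eventually_at_left intro!: exI[of _ a] less_imp_le)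
  qed simp
  define W where "W t = u' t * v t - u t * v' t" for t
  have dW: "(W has_real_derivative (q t - p t) * u t * v t) (at t)" if "a \<le> t" "t \<le> b" for t
    unfolding W_def[abs_def]
    by (rule DERIV_cong[OF DERIV_diff[OF DERIV_mult[OF du(2) dv(1)] DERIV_mult[OF du(1) dv(2)]]])
       (use that in \<open>auto simp: algebra_simps\<close>)
  have W_nonneg: "(q t - p t) * u t * v t \<ge> 0" if "a \<le> t" "t \<le> b" for t
  proof (cases "t = a \<or> t = b")
    case False
    with that have "a < t" "t < b" by auto
    then show ?thesis using le upos vpos by (simp add: less_imp_le)
  qed (use u0 in auto)
  have mono: "W x \<le> W y" if "a \<le> x" "x \<le> y" "y \<le> b" for x y
    using that dW W_nonneg by (intro DERIV_nonneg_imp_nondecreasing[of x y W]) (meson order_trans)+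
  have "W b \<le> 0" "0 \<le> W a"
    using u0 \<open>u' a \<ge> 0\<close> \<open>u' b \<le> 0\<close> \<open>v a \<ge> 0\<close> \<open>v b \<ge> 0\<close>
    by (auto simp: W_def mult_nonpos_nonneg)
  then have const: "W x = 0" if "a \<le> x" "x \<le> b" for x
    using mono[of a x] mono[of x b] that by auto
  have "(q s - p s) * u s * v s = 0"
  proof (rule DERIV_local_const[OF dW])
    show "0 < min (s - a) (b - s)" using s by simp
    show "\<forall>y. \<bar>s - y\<bar> < min (s - a) (b - s) \<longrightarrow> W s = W y"
      using const s by (auto simp: abs_if split: if_splits)
  qed (use s in auto)
  then show ?thesis using upos[OF s] vpos[OF s] by simp
qed

text \<open>
  If the second gap were at least as long as the first, sliding \<open>v\<close> to the left end of the first
  one would put two nonvanishing solutions on \<open>(a, b)\<close>, and \<open>sturm_separation\<close> would make the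
  coefficients agree on the whole interval, that is, at infinitely many points. The conditions on
  the coefficients concern only shifts \<open>s\<close> inside both gaps, since nothing is known about a
  coefficient outside its own gap.
\<close>

lemma sturm_gap:
  assumes "a < b" "c < d"
    and u: "sturm_solution p {a..b} u u'" and v: "sturm_solution q {c..d} v v'"
    and u0: "u a = 0" "u b = 0"
    and unz: "\<And>t. a < t \<Longrightarrow> t < b \<Longrightarrow> u t \<noteq> 0"
    and vnz: "\<And>t. c < t \<Longrightarrow> t < d \<Longrightarrow> v t \<noteq> 0"
    and le: "\<And>s. 0 < s \<Longrightarrow> s < b - a \<Longrightarrow> s < d - c \<Longrightarrow> p (a + s) \<le> q (c + s)"
    and fin: "finite {s. 0 < s \<and> s < b - a \<and> s < d - c \<and> p (a + s) = q (c + s)}"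
  shows "d - c < b - a"
proof (rule ccontr)
  assume "\<not> d - c < b - a"
  then have len: "b - a \<le> d - c" by simp
  define h where "h = c - a"
  have v2: "sturm_solution (\<lambda>t. q (t + h)) {a..b} (\<lambda>t. v (t + h)) (\<lambda>t. v' (t + h))"
    by (rule sturm_solution_shift, rule sturm_solution_subset[OF v]) (use len in \<open>auto simp: h_def\<close>)
  have cu: "continuous_on {a<..<b} u" and cv: "continuous_on {a<..<b} (\<lambda>t. v (t + h))"
    using sturm_solution_continuous_on[OF u] sturm_solution_continuous_on[OF v2]
    by (auto elim!: continuous_on_subset)
  obtain k where k: "\<And>t. a < t \<Longrightarrow> t < b \<Longrightarrow> k * u t > 0"
    using constant_sign[OF cu] unz by metis
  obtain l where l: "\<And>t. a < t \<Longrightarrow> t < b \<Longrightarrow> l * v (t + h) > 0"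
  proof (rule constant_sign[OF cv])
    show "v (t + h) \<noteq> 0" if "a < t" "t < b" for t
      using that len by (intro vnz) (auto simp: h_def)
  qed blast
  have le': "p t \<le> q (t + h)" if "a < t" "t < b" for t
    using le[of "t - a"] that len by (simp add: h_def algebra_simps)
  have eq: "p t = q (t + h)" if "a < t" "t < b" for t
    by (rule sturm_separation[OF \<open>a < b\<close> sturm_solution_cmult[OF u, of k]
          sturm_solution_cmult[OF v2, of l]])
       (use u0 k l le' that in auto)
  have "p (a + s) = q (c + s)" if "0 < s" "s < b - a" for s
    using eq[of "a + s"] that by (simp add: h_def algebra_simps)
  then have "{0<..<b - a} \<subseteq> {s. 0 < s \<and> s < b - a \<and> s < d - c \<and> p (a + s) = q (c + s)}"
    using len by auto
  then have "finite {0<..<b - a}" using fin by (rule finite_subset)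
  then show False using \<open>a < b\<close> infinite_Ioo[of 0 "b - a"] by simp
qed

lemma consecutive_zerosD:
  assumes "consecutive_zeros f a b x y"
  shows "a < x" "x < y" "y < b" "f x = 0" "f y = 0" "\<And>t. x < t \<Longrightarrow> t < y \<Longrightarrow> f t \<noteq> 0"
proof -
  show "a < x" "x < y" "y < b" "f x = 0" "f y = 0"
    using assms by (auto simp: consecutive_zeros_def zeros_in_def)
  show "f t \<noteq> 0" if "x < t" "t < y" for t
  proof
    assume "f t = 0"
    with that \<open>a < x\<close> \<open>y < b\<close> have "t \<in> zeros_in f a b \<inter> {x<..<y}"
      by (auto simp: zeros_in_def)
    with assms show False by (auto simp: consecutive_zeros_def)
  qed
qed

text \<open>
  Both directions compare the gaps \<open>(x, y)\<close> and \<open>(y, z)\<close>, where \<open>y + s\<close> lies to the right of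
  \<open>x + s\<close>; the one with the larger coefficient plays the second, shorter, role in \<open>sturm_gap\<close>.
\<close>

lemma zeros_concave_on_if_increasing:
  assumes sol: "sturm_solution p {lo<..<hi} u u'"
    and incr: "\<And>s t. lo < s \<Longrightarrow> s < t \<Longrightarrow> t < hi \<Longrightarrow> p s < p t"
  shows "zeros_concave_on u lo hi"
  unfolding zeros_concave_on_def
proof (intro allI impI, elim conjE)
  fix x y z assume xy: "consecutive_zeros u lo hi x y" and yz: "consecutive_zeros u lo hi y z"
  note xy = consecutive_zerosD[OF xy] and yz = consecutive_zerosD[OF yz]
  have lt: "p (x + s) < p (y + s)" if "0 < s" "s < y - x" "s < z - y" for s
    using that xy yz by (intro incr) auto
  show "z - y < y - x"
  proof (rule sturm_gap[OF \<open>x < y\<close> \<open>y < z\<close>])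
    show "sturm_solution p {x..y} u u'" "sturm_solution p {y..z} u u'"
      by (rule sturm_solution_subset[OF sol]; use xy yz in auto)+
    have none: "{s. 0 < s \<and> s < y - x \<and> s < z - y \<and> p (x + s) = p (y + s)} = {}"
      using lt by fastforce
    show "finite {s. 0 < s \<and> s < y - x \<and> s < z - y \<and> p (x + s) = p (y + s)}"
      unfolding none by simp
  qed (use xy yz lt in \<open>auto simp: less_imp_le\<close>)
qed

lemma zeros_convex_on_if_decreasing:
  assumes sol: "sturm_solution p {lo<..<hi} u u'"
    and decr: "\<And>s t. lo < s \<Longrightarrow> s < t \<Longrightarrow> t < hi \<Longrightarrow> p t < p s"
  shows "zeros_convex_on u lo hi"
  unfolding zeros_convex_on_def
proof (intro allI impI, elim conjE)
  fix x y z assume xy: "consecutive_zeros u lo hi x y" and yz: "consecutive_zeros u lo hi y z"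
  note xy = consecutive_zerosD[OF xy] and yz = consecutive_zerosD[OF yz]
  have lt: "p (y + s) < p (x + s)" if "0 < s" "s < z - y" "s < y - x" for s
    using that xy yz by (intro decr) auto
  show "y - x < z - y"
  proof (rule sturm_gap[OF \<open>y < z\<close> \<open>x < y\<close>])
    show "sturm_solution p {y..z} u u'" "sturm_solution p {x..y} u u'"
      by (rule sturm_solution_subset[OF sol]; use xy yz in auto)+
    have none: "{s. 0 < s \<and> s < z - y \<and> s < y - x \<and> p (y + s) = p (x + s)} = {}"
      using lt by fastforce
    show "finite {s. 0 < s \<and> s < z - y \<and> s < y - x \<and> p (y + s) = p (x + s)}"
      unfolding none by simp
  qed (use xy yz lt in \<open>auto simp: less_imp_le\<close>)
qed

text \<open>
  The bounds on a single gap come from the constant coefficient \<open>K\<close>, whose solution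
  \<open>sin (sqrt K * t)\<close> has the gap \<open>(0, \<pi> / sqrt K)\<close>. The two lemmas differ in which solution
  plays the role of the slower one.
\<close>

lemma sin_gap_nonzero:
  assumes "K > 0" "0 < t" "t < pi / sqrt K"
  shows "sin (sqrt K * t) \<noteq> 0"
  using sin_gt_zero[of "sqrt K * t"] assms by (simp add: field_simps)

lemma gap_greater:
  assumes "x < y" "K > 0" and sol: "sturm_solution p {x..y} u u'"
    and u0: "u x = 0" "u y = 0" and nz: "\<And>t. x < t \<Longrightarrow> t < y \<Longrightarrow> u t \<noteq> 0"
    and le: "\<And>t. x < t \<Longrightarrow> t < y \<Longrightarrow> p t \<le> K"
    and fin: "finite {t. x < t \<and> t < y \<and> p t = K}"
  shows "pi / sqrt K < y - x"
proof -
  have "pi / sqrt K - 0 < y - x"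
  proof (rule sturm_gap[OF \<open>x < y\<close> _ sol sturm_solution_sin[OF \<open>K > 0\<close>] u0])
    show "finite {s. 0 < s \<and> s < y - x \<and> s < pi / sqrt K - 0 \<and> p (x + s) = K}"
    proof (rule finite_subset[OF _ finite_imageI[OF fin]])
      show "{s. 0 < s \<and> s < y - x \<and> s < pi / sqrt K - 0 \<and> p (x + s) = K}
          \<subseteq> (\<lambda>t. t - x) ` {t. x < t \<and> t < y \<and> p t = K}"
      proof
        fix s assume "s \<in> {s. 0 < s \<and> s < y - x \<and> s < pi / sqrt K - 0 \<and> p (x + s) = K}"
        then show "s \<in> (\<lambda>t. t - x) ` {t. x < t \<and> t < y \<and> p t = K}"
          by (intro image_eqI[of _ _ "x + s"]) auto
      qed
    qed
  qed (use assms sin_gap_nonzero in auto)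
  then show ?thesis by simp
qed

lemma gap_less:
  assumes "x < y" "K > 0" and sol: "sturm_solution p {x..y} u u'"
    and nz: "\<And>t. x < t \<Longrightarrow> t < y \<Longrightarrow> u t \<noteq> 0"
    and ge: "\<And>t. x < t \<Longrightarrow> t < y \<Longrightarrow> K \<le> p t"
    and fin: "finite {t. x < t \<and> t < y \<and> p t = K}"
  shows "y - x < pi / sqrt K"
proof -
  have "y - x < pi / sqrt K - 0"
  proof (rule sturm_gap[OF _ \<open>x < y\<close> sturm_solution_sin[OF \<open>K > 0\<close>] sol])
    show "finite {s. 0 < s \<and> s < pi / sqrt K - 0 \<and> s < y - x \<and> K = p (x + s)}"
    proof (rule finite_subset[OF _ finite_imageI[OF fin]])
      show "{s. 0 < s \<and> s < pi / sqrt K - 0 \<and> s < y - x \<and> K = p (x + s)}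
          \<subseteq> (\<lambda>t. t - x) ` {t. x < t \<and> t < y \<and> p t = K}"
      proof
        fix s assume "s \<in> {s. 0 < s \<and> s < pi / sqrt K - 0 \<and> s < y - x \<and> K = p (x + s)}"
        then show "s \<in> (\<lambda>t. t - x) ` {t. x < t \<and> t < y \<and> p t = K}"
          by (intro image_eqI[of _ _ "x + s"]) auto
      qed
    qed
  qed (use assms sin_gap_nonzero in auto)
  then show ?thesis by simp
qed

section \<open>Monotonicity of the coefficient function\<close>

lemma quadratic_less:
  fixes A B v w :: real
  assumes "0 < B" "v < w" "w \<le> A / (2 * B)"
  shows "A * v - B * v\<^sup>2 < A * w - B * w\<^sup>2"
proof -
  have "2 * B * w \<le> A" "B * v < B * w" using assms by (auto simp: field_simps)
  then have "B * (v + w) < A" unfolding distrib_left by linarith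
  then have "0 < (w - v) * (A - B * (v + w))"
    using assms by (intro mult_pos_pos) auto
  then show ?thesis by (simp add: algebra_simps power2_eq_square)
qed

lemma quadratic_greater:
  fixes A B v w :: real
  assumes "0 < B" "v < w" "A / (2 * B) \<le> v"
  shows "A * w - B * w\<^sup>2 < A * v - B * v\<^sup>2"
proof -
  have "A \<le> 2 * B * v" "B * v < B * w" using assms by (auto simp: field_simps)
  then have "A < B * (v + w)" unfolding distrib_left by linarith
  then have "0 < (w - v) * (B * (v + w) - A)"
    using assms by (intro mult_pos_pos) auto
  then show ?thesis by (simp add: algebra_simps power2_eq_square)
qed

text \<open>
  In the variable \<open>w = 1 / (1 - t\<^sup>2)\<close>, which increases with \<open>\<bar>t\<bar>\<close>, the function \<open>G\<close> is the parabola
  of the two preceding lemmas, and \<open>T\<close> is the point where \<open>w\<close> reaches its vertex \<open>A / (2 B)\<close>.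
  The condition \<open>2 B < A\<close> puts that vertex beyond \<open>w = 1\<close>, so that \<open>T\<close> is positive.
\<close>

lemma coefficient_monotone:
  fixes A B T :: real
  defines "G \<equiv> \<lambda>t. A / (1 - t\<^sup>2) - B / (1 - t\<^sup>2)\<^sup>2"
  assumes B: "0 < B" "2 * B < A" and T: "T = sqrt ((A - 2 * B) / A)"
  shows "0 < T" "T < 1"
    and "\<And>s t. \<bar>s\<bar> < \<bar>t\<bar> \<Longrightarrow> \<bar>t\<bar> \<le> T \<Longrightarrow> G s < G t"
    and "\<And>s t. T \<le> \<bar>s\<bar> \<Longrightarrow> \<bar>s\<bar> < \<bar>t\<bar> \<Longrightarrow> \<bar>t\<bar> < 1 \<Longrightarrow> G t < G s"
proof -
  define w where "w t = 1 / (1 - t\<^sup>2)" for t :: real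
  have G: "G t = A * w t - B * (w t)\<^sup>2" for t
    by (simp add: G_def w_def power_divide)
  show T01: "0 < T" "T < 1" using B by (simp_all add: T)
  have "T\<^sup>2 = (A - 2 * B) / A" using B by (simp add: T)
  then have "1 - T\<^sup>2 = 2 * B / A" using B by (simp add: field_simps)
  then have wT: "w T = A / (2 * B)" by (simp add: w_def)
  have sq: "s\<^sup>2 < t\<^sup>2" if "\<bar>s\<bar> < \<bar>t\<bar>" for s t :: real
    using that power_strict_mono[of "\<bar>s\<bar>" "\<bar>t\<bar>" 2] by simp
  have w: "w s < w t" if "\<bar>s\<bar> < \<bar>t\<bar>" "\<bar>t\<bar> < 1" for s t
    using sq[OF that(1)] sq[of t 1] that(2) by (simp add: w_def frac_less2)
  have w_abs: "w s = w t" if "\<bar>s\<bar> = \<bar>t\<bar>" for s t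
    using that by (metis w_def power2_abs)
  have w_le: "w s \<le> w t" if "\<bar>s\<bar> \<le> \<bar>t\<bar>" "\<bar>t\<bar> < 1" for s t
    using w[of s t] w_abs[of s t] that by fastforce
  show "G s < G t" if "\<bar>s\<bar> < \<bar>t\<bar>" "\<bar>t\<bar> \<le> T" for s t
    unfolding G using that T01 w_le[of t T] w[of s t] by (intro quadratic_less B) (auto simp: wT)
  show "G t < G s" if "T \<le> \<bar>s\<bar>" "\<bar>s\<bar> < \<bar>t\<bar>" "\<bar>t\<bar> < 1" for s t
    unfolding G using that T01 w_le[of T s] w[of s t] by (intro quadratic_greater B) (auto simp: wT)
qed

theorem theorem5p3:
  fixes n :: nat and \<alpha> T1 T2 :: real and F :: "real \<Rightarrow> real"
  assumes "n > 0"
    and "real n + \<alpha> > 0"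
    and "real n + 2 * \<alpha> > 0"
    and F: "\<And>t. F t =
          (- (\<alpha> + real n) * (\<alpha> + real n + 1) * t\<^sup>2
             + (1 + real n + (real n)\<^sup>2 + \<alpha> + 2 * \<alpha> * real n)) / (t\<^sup>2 - 1)\<^sup>2"
    and "\<bar>\<alpha>\<bar> > 1"
    and "(real n + \<alpha>) * (real n + \<alpha> + 1) > 2 * (\<alpha>\<^sup>2 - 1)"
    and T2: "T2 = sqrt (((real n + \<alpha>) * (real n + \<alpha> + 1) - 2 * (\<alpha>\<^sup>2 - 1))
                        / ((real n + \<alpha>) * (real n + \<alpha> + 1)))"
    and T1: "T1 = - T2"
  shows "zeros_concave_on (ultraspherical n \<alpha>) (-1) T1 \<and>
         zeros_concave_on (ultraspherical n \<alpha>) 0 T2 \<and>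
         zeros_convex_on (ultraspherical n \<alpha>) T1 0 \<and>
         zeros_convex_on (ultraspherical n \<alpha>) T2 1 \<and>
         (\<forall>x y. consecutive_zeros (ultraspherical n \<alpha>) (-1) 1 x y \<longrightarrow>
            y - x > pi / sqrt (F T2) \<and>
            ({x<..<y} \<subseteq> {T1<..<T2} \<longrightarrow> y - x < pi / sqrt (F 0)) \<and>
            ({x<..<y} \<subseteq> {0<..<T2} \<longrightarrow>
               pi / sqrt (F y) < y - x \<and> y - x < pi / sqrt (F x)))"
proof -
  define A where "A = (real n + \<alpha>) * (real n + \<alpha> + 1)"
  define B where "B = \<alpha>\<^sup>2 - 1"
  have B: "0 < B" "2 * B < A"
    using assms power_strict_mono[of 1 "\<bar>\<alpha>\<bar>" 2] by (auto simp: A_def B_def)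
  have FG: "F t = A / (1 - t\<^sup>2) - B / (1 - t\<^sup>2)\<^sup>2" if "\<bar>t\<bar> < 1" for t
  proof -
    have "1 - t\<^sup>2 \<noteq> 0" using that abs_square_less_1[of t] by simp
    then have "A / (1 - t\<^sup>2) - B / (1 - t\<^sup>2)\<^sup>2 = (A * (1 - t\<^sup>2) - B) / (1 - t\<^sup>2)\<^sup>2"
      by (simp add: diff_divide_distrib power2_eq_square)
    also have "\<dots> = F t"
      unfolding F power2_commute[of "t\<^sup>2"]
      by (rule arg_cong2[of _ _ _ _ "(/)"]) (simp_all add: A_def B_def algebra_simps power2_eq_square)
    finally show ?thesis by simp
  qed
  have T2': "T2 = sqrt ((A - 2 * B) / A)" unfolding A_def B_def by (rule T2)
  note mono = coefficient_monotone[OF B T2']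
  have T01: "0 < T2" "T2 < 1" by (fact mono)+
  have inc: "F s < F t" if "\<bar>s\<bar> < \<bar>t\<bar>" "\<bar>t\<bar> \<le> T2" for s t
    using mono(3)[OF that] FG[of s] FG[of t] that T01 by simp
  have dec: "F t < F s" if "T2 \<le> \<bar>s\<bar>" "\<bar>s\<bar> < \<bar>t\<bar>" "\<bar>t\<bar> < 1" for s t
    using mono(4)[OF that] FG[of s] FG[of t] that T01 by simp
  have F0: "F 0 > 0" using FG[of 0] B by simp
  have F0_less: "F 0 < F t" if "t \<noteq> 0" "\<bar>t\<bar> \<le> T2" for t
    using inc[of 0 t] that by simp
  have less_max: "F t < F T2" if "\<bar>t\<bar> \<noteq> T2" "\<bar>t\<bar> < 1" for t
    using inc[of t T2] dec[of T2 t] that T01 by linarith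
  have F_pm_T2: "F t = F T2" if "\<bar>t\<bar> = T2" for t
    using that by (auto simp: F abs_if split: if_splits)
  obtain u u' where
    u: "\<And>t. \<bar>t\<bar> < 1 \<Longrightarrow> (u has_real_derivative u' t) (at t)"
       "\<And>t. \<bar>t\<bar> < 1 \<Longrightarrow> (u' has_real_derivative - (A / (1 - t\<^sup>2) - B / (1 - t\<^sup>2)\<^sup>2) * u t) (at t)"
    and u0: "\<And>t. \<bar>t\<bar> < 1 \<Longrightarrow> u t = 0 \<longleftrightarrow> ultraspherical n \<alpha> t = 0"
    using ultraspherical_normal_form[of n \<alpha>] unfolding A_def B_def by metis
  have sol: "sturm_solution F S u u'" if "S \<subseteq> {-1<..<1}" for S
    unfolding sturm_solution_def
  proof
    fix t assume "t \<in> S"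
    with that have "t \<in> {-1<..<1}" by blast
    then have "\<bar>t\<bar> < 1" by auto
    with u[OF this] FG[OF this] show "(u has_real_derivative u' t) (at t) \<and>
        (u' has_real_derivative - F t * u t) (at t)" by simp
  qed
  \<comment> \<open>From here on \<open>u\<close> can stand in for the polynomial: only the zero sets enter the conclusions.\<close>
  have cz: "consecutive_zeros (ultraspherical n \<alpha>) lo hi = consecutive_zeros u lo hi"
    if "-1 \<le> lo" "hi \<le> 1" for lo hi
  proof -
    have "zeros_in (ultraspherical n \<alpha>) lo hi = zeros_in u lo hi"
      using that u0 by (auto simp: zeros_in_def)
    then show ?thesis by (simp add: consecutive_zeros_def fun_eq_iff)
  qed
  have concave: "zeros_concave_on (ultraspherical n \<alpha>) lo hi"
    if "-1 \<le> lo" "hi \<le> 1" "\<And>s t. lo < s \<Longrightarrow> s < t \<Longrightarrow> t < hi \<Longrightarrow> F s < F t" for lo hi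
  proof -
    have "{lo<..<hi} \<subseteq> {-1<..<1}" using that(1,2) by auto
    from zeros_concave_on_if_increasing[OF sol[OF this] that(3)] show ?thesis
      using that(1,2) by (simp add: zeros_concave_on_def cz)
  qed
  have convex: "zeros_convex_on (ultraspherical n \<alpha>) lo hi"
    if "-1 \<le> lo" "hi \<le> 1" "\<And>s t. lo < s \<Longrightarrow> s < t \<Longrightarrow> t < hi \<Longrightarrow> F t < F s" for lo hi
  proof -
    have "{lo<..<hi} \<subseteq> {-1<..<1}" using that(1,2) by auto
    from zeros_convex_on_if_decreasing[OF sol[OF this] that(3)] show ?thesis
      using that(1,2) by (simp add: zeros_convex_on_def cz)
  qed
  have "zeros_concave_on (ultraspherical n \<alpha>) (-1) T1"
    using T01 by (intro concave dec) (auto simp: T1)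
  moreover have "zeros_concave_on (ultraspherical n \<alpha>) 0 T2"
    using T01 by (intro concave inc) auto
  moreover have "zeros_convex_on (ultraspherical n \<alpha>) T1 0"
    using T01 by (intro convex inc) (auto simp: T1)
  moreover have "zeros_convex_on (ultraspherical n \<alpha>) T2 1"
    using T01 by (intro convex dec) auto
  moreover have "y - x > pi / sqrt (F T2) \<and>
            ({x<..<y} \<subseteq> {T1<..<T2} \<longrightarrow> y - x < pi / sqrt (F 0)) \<and>
            ({x<..<y} \<subseteq> {0<..<T2} \<longrightarrow>
               pi / sqrt (F y) < y - x \<and> y - x < pi / sqrt (F x))"
    if "consecutive_zeros (ultraspherical n \<alpha>) (-1) 1 x y" for x y
  proof -
    from that have "consecutive_zeros u (-1) 1 x y" by (simp add: cz)
    note xy = consecutive_zerosD[OF this]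
    have sol': "sturm_solution F {x..y} u u'" using xy by (intro sol) auto
    have below: "pi / sqrt K < y - x"
      if "K > 0" "\<And>t. x < t \<Longrightarrow> t < y \<Longrightarrow> F t \<le> K" "finite {t. x < t \<and> t < y \<and> F t = K}" for K
      using gap_greater[OF xy(2) that(1) sol' xy(4,5) xy(6) that(2,3)] .
    have above: "y - x < pi / sqrt K"
      if "K > 0" "\<And>t. x < t \<Longrightarrow> t < y \<Longrightarrow> K \<le> F t" "finite {t. x < t \<and> t < y \<and> F t = K}" for K
      using gap_less[OF xy(2) that(1) sol' xy(6) that(2,3)] .
    have "pi / sqrt (F T2) < y - x"
    proof (rule below)
      show "F T2 > 0" using F0 F0_less[of T2] T01 by simp
      show "F t \<le> F T2" if "x < t" "t < y" for t
        using less_max[of t] F_pm_T2[of t] that xy(1,3) by fastforce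
      \<comment> \<open>The maximum is attained at two points only, which a gap may contain.\<close>
      have "t \<in> {T2, - T2}" if "x < t" "t < y" "F t = F T2" for t
      proof -
        have "\<bar>t\<bar> < 1" using that xy(1,3) by (simp add: abs_less_iff)
        then have "\<bar>t\<bar> = T2" using less_max[of t] that(3) by force
        then show ?thesis by (auto simp: abs_if split: if_splits)
      qed
      then have "{t. x < t \<and> t < y \<and> F t = F T2} \<subseteq> {T2, - T2}" by blast
      then show "finite {t. x < t \<and> t < y \<and> F t = F T2}"
        by (rule finite_subset) simp
    qed
    moreover have "y - x < pi / sqrt (F 0)" if "{x<..<y} \<subseteq> {T1<..<T2}"
    proof (rule above[OF F0])
      have T: "\<bar>t\<bar> \<le> T2" if "x < t" "t < y" for t
        using that \<open>{x<..<y} \<subseteq> {T1<..<T2}\<close> by (fastforce simp: T1)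
      show "F 0 \<le> F t" if "x < t" "t < y" for t
        using F0_less[of t] T[OF that] by (cases "t = 0") auto
      have "t = 0" if "x < t" "t < y" "F t = F 0" for t
        using F0_less[of t] T[OF that(1,2)] that(3) by force
      then have "{t. x < t \<and> t < y \<and> F t = F 0} \<subseteq> {0}" by blast
      then show "finite {t. x < t \<and> t < y \<and> F t = F 0}"
        by (rule finite_subset) simp
    qed
    moreover have "pi / sqrt (F y) < y - x \<and> y - x < pi / sqrt (F x)" if "{x<..<y} \<subseteq> {0<..<T2}"
    proof -
      have "0 \<le> x" "y \<le> T2"
        using that xy(2) by (auto simp: greaterThanLessThan_subseteq_greaterThanLessThan)
      then have Fx: "F x < F t" and Fy: "F t < F y" if "x < t" "t < y" for t
        using that inc[of x t] inc[of t y] by auto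
      have pos: "F x > 0" "F y > 0"
        using F0 F0_less[of x] F0_less[of y] xy(2) \<open>0 \<le> x\<close> \<open>y \<le> T2\<close> by (cases "x = 0"; auto)+
      have none: "{t. x < t \<and> t < y \<and> F t = F y} = {}" "{t. x < t \<and> t < y \<and> F t = F x} = {}"
        using Fx Fy by fastforce+
      show ?thesis
        using below[OF pos(2)] above[OF pos(1)] Fx Fy by (auto simp: none less_imp_le)
    qed
    ultimately show ?thesis by blast
  qed
  ultimately show ?thesis by blast
qed

end
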